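(* Let $d\ge2$, let $\Pi_T$ be the order transform of the $d$-dimensional product copula $\Pi$, and let $b:\{1,\dots,d\}\to\{1,\dots,d\}$, $b(i):=d-i+1$. Then for every $K\subseteq\{1,\dots,d\}$ with $|K|\ge2$, $$\big[\varrho_{b(K)}(\Pi_T),\varrho_{b(K)}(\Pi_T)\big]=\big[\varrho_K(\Pi_T),\varrho_K(\Pi_T)\big].$$ In particular, for every $K\subseteq\{1,\dots,d\}$ with $|K|\ge2$, $$\kappa[\varrho_{b(K)}(\Pi_T)]=\kappa[\varrho_K(\Pi_T)].$$
   Context: Notation: $\overline{\mathbb R}=[-\infty,\infty]$. The product copula is $\Pi(\mathbf u)=\prod_{k=1}^d u_k$ on $[0,1]^d$. For a copula $C$ on $[0,1]^n$, $Q^C$ is the unique Borel probability measure on $[0,1]^n$ with $Q^C[[\mathbf 0,\mathbf u]]=C(\mathbf u)$ for all $\mathbf u\in[0,1]^n$. Kendall's tau: for $n$-dimensional copulas $C,D$ ($n\ge2$) put $[C,D]:=\int_{[0,1]^n}C(\mathbf u)\,dQ^D(\mathbf u)$ and $\kappa[C]:=\dfrac{2^n[C,C]-1}{2^{n-1}-1}$. Margin: for $K=\{k_1<\dots<k_{|K|}\}\subseteq\{1,\dots,d\}$ with $|K|\ge2$ and a copula $C$ on $[0,1]^d$, $\varrho_K(C)$ is the $|K|$-dimensional copula $\varrho_K(C)(\mathbf v):=C(\tilde\varrho_K(\mathbf v))$, where $\tilde\varrho_K(\mathbf v)\in[0,1]^d$ has $k_j$-th coordinate equal to the $j$-th coordinate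 of $\mathbf v$ and all coordinates outside $K$ equal to $1$. Order transform: $T:\overline{\mathbb R}^d\to\overline{\mathbb R}^d$ is $(T(\mathbf x))_k:=\min_{J\subseteq\{1,\dots,d\},|J|=k}\max_{l\in J}x_l$, i.e. $T(\mathbf x)$ is the nondecreasing rearrangement of $\mathbf x$. For a copula $C$, let $H^C:\overline{\mathbb R}^d\to[0,1]$ be the distribution function extending $C$, i.e. $H^C(\mathbf x)=C(h(x_1),\dots,h(x_d))$ with $h(x)=\max\{0,\min\{x,1\}\}$, and let $Q^{H^C}$ be the corresponding probability measure. Let $H^C_T$ be the distribution function of the image measure $(Q^{H^C})_T=Q^{H^C}\circ T^{-1}$. Its univariate marginal distribution functions $(H^C_T)_1,\dots,(H^C_T)_d$ are continuous, so there is a unique copula $C_T$, called the order transform of $C$, with $H^C_T(\mathbf x)=C_T\big((H^C_T)_1(x_1),\dots,(H^C_T)_d(x_d)\big)$ for all $\mathbf x\in\overline{\mathbb R}^d$. *)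

theory Defs
  imports "HOL-Probability.Probability"
begin

text \<open>
  Points of an \<open>n\<close>-dimensional space are extensional functions on the index set \<open>{1..n}\<close>.
  A copula is extensional on the unit cube, so that equality of copulas is equality of functions.
\<close>

definition icube :: "nat \<Rightarrow> (nat \<Rightarrow> real) set" where
  "icube n = {1..n} \<rightarrow>\<^sub>E {0..1}"

definition copula :: "nat \<Rightarrow> ((nat \<Rightarrow> real) \<Rightarrow> real) \<Rightarrow> bool" where
  "copula n C \<longleftrightarrow>
     C \<in> icube n \<rightarrow>\<^sub>E {0..1} \<and>
     (\<forall>u\<in>icube n. (\<exists>k\<in>{1..n}. u k = 0) \<longrightarrow> C u = 0) \<and>
     (\<forall>u\<in>icube n. \<forall>k\<in>{1..n}. (\<forall>i\<in>{1..n} - {k}. u i = 1) \<longrightarrow> C u = u k) \<and>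
     (\<forall>u\<in>icube n. \<forall>v\<in>icube n. (\<forall>i\<in>{1..n}. u i \<le> v i) \<longrightarrow>
        0 \<le> (\<Sum>S\<in>Pow {1..n}. (-1) ^ card S * C (\<lambda>i\<in>{1..n}. if i \<in> S then u i else v i)))"

definition product_copula :: "nat \<Rightarrow> (nat \<Rightarrow> real) \<Rightarrow> real" where
  "product_copula d = (\<lambda>u\<in>icube d. \<Prod>k\<in>{1..d}. u k)"

definition icube_borel :: "nat \<Rightarrow> (nat \<Rightarrow> real) measure" where
  "icube_borel n = PiM {1..n} (\<lambda>_. restrict_space borel {0..1})"

definition copula_measure :: "nat \<Rightarrow> ((nat \<Rightarrow> real) \<Rightarrow> real) \<Rightarrow> (nat \<Rightarrow> real) measure" where
  "copula_measure n C = (THE Q. prob_space Q \<and> sets Q = sets (icube_borel n) \<and>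
     (\<forall>u\<in>icube n. measure Q {v \<in> icube n. \<forall>i\<in>{1..n}. v i \<le> u i} = C u))"

definition bracket :: "nat \<Rightarrow> ((nat \<Rightarrow> real) \<Rightarrow> real) \<Rightarrow> ((nat \<Rightarrow> real) \<Rightarrow> real) \<Rightarrow> real" where
  "bracket n C D = (\<integral>u. C u \<partial>(copula_measure n D))"

definition kendall_tau :: "nat \<Rightarrow> ((nat \<Rightarrow> real) \<Rightarrow> real) \<Rightarrow> real" where
  "kendall_tau n C = (2 ^ n * bracket n C C - 1) / (2 ^ (n - 1) - 1)"

text \<open>
  For \<open>i \<in> K\<close>, the number \<open>card {k \<in> K. k \<le> i}\<close> is the position \<open>j\<close> of \<open>i\<close> in the increasing
  enumeration \<open>k\<^sub>1 < k\<^sub>2 < \<dots>\<close> of \<open>K\<close>.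
\<close>

definition margin_embed :: "nat \<Rightarrow> nat set \<Rightarrow> (nat \<Rightarrow> real) \<Rightarrow> nat \<Rightarrow> real" where
  "margin_embed d K v = (\<lambda>i\<in>{1..d}. if i \<in> K then v (card {k\<in>K. k \<le> i}) else 1)"

definition margin :: "nat \<Rightarrow> nat set \<Rightarrow> ((nat \<Rightarrow> real) \<Rightarrow> real) \<Rightarrow> (nat \<Rightarrow> real) \<Rightarrow> real" where
  "margin d K C = (\<lambda>v\<in>icube (card K). C (margin_embed d K v))"

definition ebox_borel :: "nat \<Rightarrow> (nat \<Rightarrow> ereal) measure" where
  "ebox_borel d = PiM {1..d} (\<lambda>_. borel)"

definition dist_fun :: "nat \<Rightarrow> (nat \<Rightarrow> ereal) measure \<Rightarrow> (nat \<Rightarrow> ereal) \<Rightarrow> real" where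
  "dist_fun d Q x = measure Q {y \<in> space (ebox_borel d). \<forall>i\<in>{1..d}. y i \<le> x i}"

definition dist_measure :: "nat \<Rightarrow> ((nat \<Rightarrow> ereal) \<Rightarrow> real) \<Rightarrow> (nat \<Rightarrow> ereal) measure" where
  "dist_measure d H = (THE Q. prob_space Q \<and> sets Q = sets (ebox_borel d) \<and>
     (\<forall>x\<in>space (ebox_borel d). dist_fun d Q x = H x))"

definition dist_margin :: "nat \<Rightarrow> ((nat \<Rightarrow> ereal) \<Rightarrow> real) \<Rightarrow> nat \<Rightarrow> ereal \<Rightarrow> real" where
  "dist_margin d H k t = H (\<lambda>i\<in>{1..d}. if i = k then t else \<infinity>)"

definition clip :: "ereal \<Rightarrow> real" where
  "clip x = real_of_ereal (max 0 (min x 1))"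

definition copula_extension ::
    "nat \<Rightarrow> ((nat \<Rightarrow> real) \<Rightarrow> real) \<Rightarrow> (nat \<Rightarrow> ereal) \<Rightarrow> real" where
  "copula_extension d C x = C (\<lambda>i\<in>{1..d}. clip (x i))"

definition order_map :: "nat \<Rightarrow> (nat \<Rightarrow> ereal) \<Rightarrow> nat \<Rightarrow> ereal" where
  "order_map d x = (\<lambda>k\<in>{1..d}. Min {Max (x ` J) | J. J \<subseteq> {1..d} \<and> card J = k})"

definition order_dist :: "nat \<Rightarrow> ((nat \<Rightarrow> real) \<Rightarrow> real) \<Rightarrow> (nat \<Rightarrow> ereal) \<Rightarrow> real" where
  "order_dist d C =
     dist_fun d (distr (dist_measure d (copula_extension d C)) (ebox_borel d) (order_map d))"

definition order_transform ::
    "nat \<Rightarrow> ((nat \<Rightarrow> real) \<Rightarrow> real) \<Rightarrow> (nat \<Rightarrow> real) \<Rightarrow> real" where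
  "order_transform d C = (THE D. copula d D \<and>
     (\<forall>x\<in>space (ebox_borel d).
        order_dist d C x = D (\<lambda>k\<in>{1..d}. dist_margin d (order_dist d C) k (x k))))"

definition reflect_index :: "nat \<Rightarrow> nat \<Rightarrow> nat" where
  "reflect_index d i = d - i + 1"

end

theory Submission imports Defs begin

text \<open>
  If \<open>V\<close> and \<open>V'\<close> are independent with distribution function a copula \<open>C\<close>, then
  \<open>[C, C] = P(V' \<le> V)\<close>. For \<open>C = \<rho>\<^sub>K(\<Pi>\<^sub>T)\<close> one may take \<open>V\<close> to be the order statistics
  \<open>U\<^sub>(\<^sub>k\<^sub>)\<close>, \<open>k \<in> K\<close>, of independent uniform variables, each transformed by its continuous
  distribution function; up to a null event \<open>V' \<le> V\<close> says that \<open>U'\<^sub>(\<^sub>k\<^sub>) \<le> U\<^sub>(\<^sub>k\<^sub>)\<close> for all \<open>k \<in> K\<close>.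
  The substitution \<open>U \<mapsto> 1 - U\<close> preserves the uniform distribution and turns the \<open>k\<close>-th order
  statistic into one minus the \<open>b(k)\<close>-th, so \<open>b(K)\<close> gives the probability of the reversed
  inequalities, which is the same because \<open>U\<close> and \<open>U'\<close> are exchangeable.
\<close>

section \<open>Measures determined by their distribution functions\<close>

text \<open>Boxes with sides in \<open>E\<close> form a pi-system generating the product
  sigma-algebra. As \<open>\<Omega> \<in> E\<close>, the whole space is itself such a box, so a
  constant exhausting sequence suffices.\<close>

lemma measure_eqI_PiM_generator:
  assumes "finite I" and E: "E \<subseteq> Pow \<Omega>" "\<Omega> \<in> E" "Int_stable E"
    and sets: "sets P = sets (PiM I (\<lambda>_. sigma \<Omega> E))" "sets Q = sets (PiM I (\<lambda>_. sigma \<Omega> E))"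
    and "prob_space P"
    and eq: "\<And>F. F \<in> I \<rightarrow> E \<Longrightarrow> emeasure P (Pi\<^sub>E I F) = emeasure Q (Pi\<^sub>E I F)"
  shows "P = Q"
proof (rule measure_eqI_generator_eq)
  let ?B = "{Pi\<^sub>E I F | F. \<forall>i\<in>I. F i \<in> E}"
  let ?\<Omega> = "I \<rightarrow>\<^sub>E \<Omega>"
  interpret P: prob_space P by fact
  \<comment> \<open>\<open>sets_PiM_sigma\<close> describes its generator through a family of index
    sets; the family with the single member \<open>I\<close> yields the full boxes.\<close>
  have B_eq: "?B = {{f \<in> ?\<Omega>. \<forall>i\<in>j. f i \<in> F i} | F j. j \<in> {I} \<and> F \<in> Pi j (\<lambda>_. E)}"
  proof -
    have "Pi\<^sub>E I F = {f \<in> ?\<Omega>. \<forall>i\<in>I. f i \<in> F i}" if "\<forall>i\<in>I. F i \<in> E" for F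
      using that E(1) by (auto simp: PiE_iff extensional_def)
    then have "(X = Pi\<^sub>E I F \<and> (\<forall>i\<in>I. F i \<in> E))
        \<longleftrightarrow> (X = {f \<in> ?\<Omega>. \<forall>i\<in>I. f i \<in> F i} \<and> F \<in> I \<rightarrow> E)" for X F
      by (auto simp: Pi_iff)
    then show ?thesis by simp
  qed
  have gen: "sets (PiM I (\<lambda>_. sigma \<Omega> E)) = sets (sigma ?\<Omega> ?B)"
    unfolding B_eq
  proof (rule sets_PiM_sigma)
    show "\<exists>S\<subseteq>E. countable S \<and> \<Omega> = \<Union> S"
      using E by (intro exI[of _ "{\<Omega>}"]) auto
  qed (use assms in auto)
  have B: "?B \<subseteq> Pow ?\<Omega>"
    using E(1) PiE_mono[of I _ "\<lambda>_. \<Omega>"] by blast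
  show "?B \<subseteq> Pow ?\<Omega>" by fact
  show "Int_stable ?B"
  proof (rule Int_stableI, clarify)
    fix F G assume "\<forall>i\<in>I. F i \<in> E" "\<forall>i\<in>I. G i \<in> E"
    then show "\<exists>H. Pi\<^sub>E I F \<inter> Pi\<^sub>E I G = Pi\<^sub>E I H \<and> (\<forall>i\<in>I. H i \<in> E)"
      using Int_stableD[OF E(3)] by (intro exI[of _ "\<lambda>i. F i \<inter> G i"]) (auto simp: PiE_Int)
  qed
  show "sets P = sigma_sets ?\<Omega> ?B" "sets Q = sigma_sets ?\<Omega> ?B"
    using B by (simp_all add: sets gen)
  show "range (\<lambda>_::nat. ?\<Omega>) \<subseteq> ?B" "(\<Union>_::nat. ?\<Omega>) = ?\<Omega>"
    using E(2) by auto
  show "emeasure P ?\<Omega> \<noteq> \<infinity>" by simp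
qed (use eq in auto)

text \<open>The traces on \<open>{0..1}\<close> of the half-lines \<open>{..a}\<close> generate the
  restricted sigma-algebra. Such a trace is an interval \<open>{0..u}\<close> with \<open>u\<close>
  in \<open>{0..1}\<close>, or empty when \<open>a < 0\<close>.\<close>

lemma sets_restrict_borel_eq_sigma_Icc:
  "sets (restrict_space borel {0..1::real}) = sets (sigma {0..1} ((\<lambda>u. {0..u}) ` {0..1}))"
proof
  have "(\<inter>) {0..1} ` sigma_sets UNIV (range (\<lambda>a::real. {..a}))
      = sigma_sets {0..1} ((\<inter>) {0..1} ` range (\<lambda>a. {..a}))"
    using borel_closed[of "{0..1::real}"]
    by (intro sigma_sets_Int) (auto simp: borel_eq_atMost)
  then have 1: "sets (restrict_space borel {0..1::real})
      = sigma_sets {0..1} ((\<inter>) {0..1} ` range (\<lambda>a. {..a}))"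
    by (simp add: sets_restrict_space borel_eq_atMost)
  have "{0..1} \<inter> {..a} \<in> sigma_sets {0..1} ((\<lambda>u. {0..u}) ` {0..1})" for a :: real
  proof (cases "a < 0")
    case True
    then have "{0..1} \<inter> {..a} = {}" by auto
    then show ?thesis by (metis sigma_sets.Empty)
  next
    case False
    then have "{0..1} \<inter> {..a} = {0..min a 1}" by auto
    then show ?thesis using False by (auto intro!: sigma_sets.Basic)
  qed
  then show "sets (restrict_space borel {0..1::real}) \<subseteq> sets (sigma {0..1} ((\<lambda>u. {0..u}) ` {0..1}))"
    unfolding 1 by (subst sets_measure_of) (auto intro!: sigma_sets_mono)
  show "sets (sigma {0..1} ((\<lambda>u. {0..u}) ` {0..1})) \<subseteq> sets (restrict_space borel {0..1::real})"
  proof -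
    have "{0..u} \<in> sets (restrict_space borel {0..1})" if "u \<in> {0..1}" for u :: real
      using that by (auto simp: sets_restrict_space image_iff intro!: bexI[of _ "{0..u}"])
    then have "sigma_sets (space (restrict_space borel {0..1::real})) ((\<lambda>u. {0..u}) ` {0..1})
        \<subseteq> sets (restrict_space borel {0..1::real})"
      by (intro sets.sigma_sets_subset) auto
    then show ?thesis by (subst sets_measure_of) (auto simp: space_restrict_space)
  qed
qed

lemma sets_borel_ereal_eq_sigma_atMost:
  "sets (borel :: ereal measure) = sets (sigma UNIV (range atMost))"
proof
  have "(\<lambda>x. x) \<in> measurable (sigma UNIV (range atMost)) (borel :: ereal measure)"
    by (rule borel_measurableI_le) (auto simp flip: atMost_def)
  then show "sets (borel :: ereal measure) \<subseteq> sets (sigma UNIV (range atMost))"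
    by (auto dest: measurable_sets)
  show "sets (sigma UNIV (range atMost)) \<subseteq> sets (borel :: ereal measure)"
    using sets.sigma_sets_subset[of "range atMost" "borel :: ereal measure"]
    by (simp add: image_subset_iff)
qed

lemma space_ebox_borel: "space (ebox_borel d) = {1..d} \<rightarrow>\<^sub>E UNIV"
  by (simp add: ebox_borel_def space_PiM)

lemma space_icube_borel: "space (icube_borel n) = icube n"
  by (simp add: icube_borel_def icube_def space_PiM)

lemma ebox_measure_eqI:
  assumes "prob_space P" "sets P = sets (ebox_borel d)" "prob_space Q" "sets Q = sets (ebox_borel d)"
    and eq: "\<And>x. x \<in> space (ebox_borel d) \<Longrightarrow> dist_fun d P x = dist_fun d Q x"
  shows "P = Q"
proof (rule measure_eqI_PiM_generator)
  interpret P: prob_space P by fact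
  interpret Q: prob_space Q by fact
  show "sets P = sets (PiM {1..d} (\<lambda>_. sigma UNIV (range atMost)))"
    "sets Q = sets (PiM {1..d} (\<lambda>_. sigma UNIV (range atMost)))"
    using assms sets_borel_ereal_eq_sigma_atMost unfolding ebox_borel_def
    by (auto intro!: sets_PiM_cong)
  show "Int_stable (range (atMost :: ereal \<Rightarrow> _))"
    by (rule Int_stableI) auto
  \<comment> \<open>On the extended line the whole space is the closed ray
    \<open>{..\<infinity>}\<close>, hence a member of the generator.\<close>
  show "UNIV \<in> range (atMost :: ereal \<Rightarrow> _)"
    by (rule range_eqI[of _ _ \<infinity>]) auto
  fix F :: "nat \<Rightarrow> ereal set" assume "F \<in> {1..d} \<rightarrow> range atMost"
  then have "\<forall>i\<in>{1..d}. \<exists>a. F i = {..a}" by auto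
  then obtain a where a: "\<And>i. i \<in> {1..d} \<Longrightarrow> F i = {..a i}" by metis
  have F: "Pi\<^sub>E {1..d} F
      = {y \<in> space (ebox_borel d). \<forall>i\<in>{1..d}. y i \<le> restrict a {1..d} i}"
    by (auto simp: space_ebox_borel a PiE_iff extensional_def)
  have "measure P (Pi\<^sub>E {1..d} F) = measure Q (Pi\<^sub>E {1..d} F)"
    unfolding F using eq[of "restrict a {1..d}"] by (simp add: dist_fun_def space_ebox_borel)
  then show "emeasure P (Pi\<^sub>E {1..d} F) = emeasure Q (Pi\<^sub>E {1..d} F)"
    by (simp add: P.emeasure_eq_measure Q.emeasure_eq_measure)
qed (use assms in auto)

lemma icube_measure_eqI:
  assumes "prob_space P" "sets P = sets (icube_borel n)" "prob_space Q" "sets Q = sets (icube_borel n)"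
    and eq: "\<And>u. u \<in> icube n \<Longrightarrow> measure P {v \<in> icube n. \<forall>i\<in>{1..n}. v i \<le> u i}
                = measure Q {v \<in> icube n. \<forall>i\<in>{1..n}. v i \<le> u i}"
  shows "P = Q"
proof (rule measure_eqI_PiM_generator)
  let ?E = "(\<lambda>u. {0..u}) ` {0..1::real}"
  interpret P: prob_space P by fact
  interpret Q: prob_space Q by fact
  show "sets P = sets (PiM {1..n} (\<lambda>_. sigma {0..1} ?E))"
    "sets Q = sets (PiM {1..n} (\<lambda>_. sigma {0..1} ?E))"
    using assms sets_restrict_borel_eq_sigma_Icc unfolding icube_borel_def
    by (auto intro!: sets_PiM_cong)
  show "Int_stable ?E"
    by (rule Int_stableI) (auto simp: image_iff min_def)
  show "{0..1} \<in> ?E" "?E \<subseteq> Pow {0..1}"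
    by auto
  fix F :: "nat \<Rightarrow> real set" assume "F \<in> {1..n} \<rightarrow> ?E"
  then have "\<forall>i\<in>{1..n}. \<exists>a. a \<in> {0..1} \<and> F i = {0..a}" by (auto simp: Pi_iff image_iff Bex_def)
  then obtain a where a: "\<And>i. i \<in> {1..n} \<Longrightarrow> a i \<in> {0..1}" "\<And>i. i \<in> {1..n} \<Longrightarrow> F i = {0..a i}"
    by metis
  have F: "Pi\<^sub>E {1..n} F = {v \<in> icube n. \<forall>i\<in>{1..n}. v i \<le> restrict a {1..n} i}"
  proof -
    have "Pi\<^sub>E {1..n} F = Pi\<^sub>E {1..n} (\<lambda>i. {0..a i})"
      using a(2) by (intro PiE_cong) auto
    also have "\<dots> = {v \<in> icube n. \<forall>i\<in>{1..n}. v i \<le> restrict a {1..n} i}"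
    proof -
      have "x \<le> 1" if "i \<in> {1..n}" "x \<le> a i" for x i
        using a(1)[OF that(1)] that(2) by auto
      then show ?thesis by (auto simp: icube_def PiE_iff extensional_def)
    qed
    finally show ?thesis .
  qed
  have "measure P (Pi\<^sub>E {1..n} F) = measure Q (Pi\<^sub>E {1..n} F)"
    unfolding F using a(1) by (intro eq) (auto simp: icube_def)
  then show "emeasure P (Pi\<^sub>E {1..n} F) = emeasure Q (Pi\<^sub>E {1..n} F)"
    by (simp add: P.emeasure_eq_measure Q.emeasure_eq_measure)
qed (use assms in auto)

text \<open>Uniqueness turns the definite description into a rule: exhibiting one measure with the
  right distribution function evaluates it. The next lemma does the same on the cube.\<close>

lemma dist_measure_eqI:
  assumes "prob_space Q" "sets Q = sets (ebox_borel d)"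
    and "\<And>x. x \<in> space (ebox_borel d) \<Longrightarrow> dist_fun d Q x = H x"
  shows "dist_measure d H = Q"
  unfolding dist_measure_def
  using assms by (intro the_equality) (auto intro!: ebox_measure_eqI[of _ d])

lemma copula_measure_eqI:
  assumes "prob_space Q" "sets Q = sets (icube_borel n)"
    and "\<And>u. u \<in> icube n \<Longrightarrow> measure Q {v \<in> icube n. \<forall>i\<in>{1..n}. v i \<le> u i} = C u"
  shows "copula_measure n C = Q"
  unfolding copula_measure_def
  using assms by (intro the_equality) (auto intro!: icube_measure_eqI[of _ n])

section \<open>The copula of a distribution with atomless margins\<close>

text \<open>Isolates what Sklar's construction needs from the law of the order statistics;
  \<open>order_stats d\<close> is shown to be an instance later.\<close>

locale atomless_margins = prob_space N for N :: "(nat \<Rightarrow> ereal) measure" +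
  fixes d :: nat
  assumes sets_N: "sets N = sets (ebox_borel d)"
    and no_atoms: "\<And>k t. k \<in> {1..d} \<Longrightarrow> prob {y \<in> space N. y k = t} = 0"
begin

section \<open>Marginal distribution functions and their quantiles\<close>

lemma space_N: "space N = {1..d} \<rightarrow>\<^sub>E UNIV"
  using sets_eq_imp_space_eq[OF sets_N] by (simp add: space_ebox_borel)

lemma measurable_component [measurable]: "k \<in> {1..d} \<Longrightarrow> (\<lambda>y. y k) \<in> borel_measurable N"
  unfolding measurable_cong_sets[OF sets_N refl] ebox_borel_def by measurable

definition mcdf :: "nat \<Rightarrow> ereal \<Rightarrow> real" where
  "mcdf k t = prob {y \<in> space N. y k \<le> t}"

text \<open>The upper quantile: a supremum over \<open>mcdf k s \<le> u\<close> instead of the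
  customary infimum over \<open>u \<le> mcdf k s\<close>. This choice makes it an upper adjoint of
  \<open>mcdf k\<close>.\<close>

definition quantile :: "nat \<Rightarrow> real \<Rightarrow> ereal" where
  "quantile k u = Sup {s. mcdf k s \<le> u}"

lemma mcdf_mono: "k \<in> {1..d} \<Longrightarrow> s \<le> t \<Longrightarrow> mcdf k s \<le> mcdf k t"
  unfolding mcdf_def by (intro finite_measure_mono) auto

lemma mcdf_nonneg: "0 \<le> mcdf k t" and mcdf_le_1: "mcdf k t \<le> 1"
  by (simp_all add: mcdf_def)

lemma mcdf_PInf: "mcdf k \<infinity> = 1"
  by (simp add: mcdf_def prob_space)

lemma mcdf_MInf: "k \<in> {1..d} \<Longrightarrow> mcdf k (-\<infinity>) = 0"
  using no_atoms[of k "-\<infinity>"] by (simp add: mcdf_def)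

text \<open>Continuity from below, along a sequence increasing to the quantile, controls the mass
  strictly below it; the quantile itself is not an atom.\<close>

lemma mcdf_quantile_le:
  assumes k: "k \<in> {1..d}" and "0 \<le> u"
  shows "mcdf k (quantile k u) \<le> u"
proof -
  note [measurable] = measurable_component[OF k]
  have "{s. mcdf k s \<le> u} \<noteq> {}"
    using mcdf_MInf[OF k] \<open>0 \<le> u\<close> by (auto intro!: exI[of _ "-\<infinity>"])
  from Sup_countable_SUP[OF this]
  obtain f where f: "incseq f" "range f \<subseteq> {s. mcdf k s \<le> u}" "quantile k u = (SUP n. f n)"
    by (auto simp: quantile_def)
  let ?A = "\<lambda>n. {y \<in> space N. y k \<le> f n}"
  have "(\<lambda>n. prob (?A n)) \<longlonglongrightarrow> prob (\<Union>n. ?A n)"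
    using f(1) by (intro finite_Lim_measure_incseq) (auto simp: incseq_def intro: order_trans)
  then have le: "prob (\<Union>n. ?A n) \<le> u"
    by (rule LIMSEQ_le_const2) (use f(2) in \<open>auto simp: mcdf_def\<close>)
  have "{y \<in> space N. y k \<le> quantile k u} \<subseteq> (\<Union>n. ?A n) \<union> {y \<in> space N. y k = quantile k u}"
    using f(3) by (auto simp: less_SUP_iff le_less intro: less_imp_le)
  then have "mcdf k (quantile k u) \<le> prob ((\<Union>n. ?A n) \<union> {y \<in> space N. y k = quantile k u})"
    unfolding mcdf_def by (intro finite_measure_mono) auto
  also have "\<dots> \<le> prob (\<Union>n. ?A n) + prob {y \<in> space N. y k = quantile k u}"
    by (intro measure_Un_le) auto
  finally show ?thesis using le no_atoms[OF k] by simp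
qed

text \<open>A Galois connection; that the supremum is attained needs the absence of atoms.\<close>

lemma mcdf_le_iff:
  assumes "k \<in> {1..d}" "0 \<le> u"
  shows "mcdf k s \<le> u \<longleftrightarrow> s \<le> quantile k u"
proof
  assume "s \<le> quantile k u"
  then show "mcdf k s \<le> u"
    using mcdf_mono[OF assms(1)] mcdf_quantile_le[OF assms] by (meson order_trans)
qed (auto simp: quantile_def intro: Sup_upper)

text \<open>The missing inequality is continuity from above: right of the quantile
  \<open>mcdf k\<close> exceeds \<open>u\<close>, and points there can be chosen to decrease to the
  quantile. Nothing lies to the right of infinity, but there \<open>mcdf k\<close> is 1.\<close>

lemma mcdf_quantile:
  assumes k: "k \<in> {1..d}" and u: "0 \<le> u" "u \<le> 1"
  shows "mcdf k (quantile k u) = u"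
proof (rule antisym[OF mcdf_quantile_le[OF k u(1)]])
  note [measurable] = measurable_component[OF k]
  show "u \<le> mcdf k (quantile k u)"
  proof (cases "quantile k u = \<infinity>")
    case True
    then show ?thesis using u by (simp add: mcdf_PInf)
  next
    case False
    let ?q = "quantile k u"
    have "{?q<..} \<noteq> {}" using False by (auto intro!: exI[of _ \<infinity>])
    from Inf_countable_INF[OF this]
    obtain f where f: "decseq f" "range f \<subseteq> {?q<..}" "Inf {?q<..} = (INF n. f n)"
      by auto
    have "Inf {?q<..} = ?q"
      using False by (intro Inf_eqI) (auto intro: less_imp_le dense_ge)
    with f(3) have q: "(INF n. f n) = ?q" by simp
    let ?A = "\<lambda>n. {y \<in> space N. y k \<le> f n}"
    have "(\<lambda>n. prob (?A n)) \<longlonglongrightarrow> prob (\<Inter>n. ?A n)"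
      using f(1) by (intro finite_Lim_measure_decseq) (auto simp: decseq_def intro: order_trans)
    moreover have "u \<le> prob (?A n)" for n
    proof -
      have "\<not> f n \<le> ?q" using f(2) by (auto simp: not_le)
      then show ?thesis using mcdf_le_iff[OF k u(1), of "f n"] by (simp add: mcdf_def)
    qed
    ultimately have "u \<le> prob (\<Inter>n. ?A n)"
      by (intro LIMSEQ_le_const) auto
    also have "(\<Inter>n. ?A n) = {y \<in> space N. y k \<le> ?q}"
      unfolding q[symmetric] by (auto simp: le_INF_iff)
    finally show ?thesis by (simp add: mcdf_def)
  qed
qed

text \<open>The quantile of \<open>mcdf k t\<close> lies beyond \<open>t\<close> where
  \<open>mcdf k\<close> is flat to the right of \<open>t\<close>. The gap is null because
  \<open>mcdf k\<close> has the same value at both ends.\<close>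

lemma AE_le_quantile_mcdf:
  assumes k: "k \<in> {1..d}"
  shows "AE y in N. y k \<le> quantile k (mcdf k t) \<longleftrightarrow> y k \<le> t"
proof -
  note [measurable] = measurable_component[OF k]
  let ?q = "quantile k (mcdf k t)"
  have t: "t \<le> ?q" using mcdf_le_iff[OF k mcdf_nonneg] by blast
  have "prob ({y \<in> space N. y k \<le> ?q} - {y \<in> space N. y k \<le> t})
      = prob {y \<in> space N. y k \<le> ?q} - prob {y \<in> space N. y k \<le> t}"
    using order_trans[OF _ t] by (intro finite_measure_Diff) auto
  also have "\<dots> = mcdf k ?q - mcdf k t"
    by (simp only: mcdf_def)
  also have "\<dots> = 0"
    using mcdf_quantile[OF k mcdf_nonneg mcdf_le_1] by simp
  finally have "AE y in N. y \<notin> {y \<in> space N. y k \<le> ?q} - {y \<in> space N. y k \<le> t}"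
    by (subst (asm) prob_eq_0) auto
  then show ?thesis
    using AE_space by eventually_elim (use t order_trans in blast)
qed

lemma mcdf_measurable [measurable]:
  assumes k: "k \<in> {1..d}"
  shows "mcdf k \<in> borel_measurable borel"
proof (rule borel_measurableI_le)
  fix c
  have "{x. mcdf k x \<le> c} = (if 0 \<le> c then {..quantile k c} else {})"
    using mcdf_le_iff[OF k] mcdf_nonneg[of k] by (auto intro: order_trans)
  then show "{x \<in> space borel. mcdf k x \<le> c} \<in> sets borel" by auto
qed

section \<open>The copula of the law and Sklar's identity\<close>

definition cop :: "(nat \<Rightarrow> real) \<Rightarrow> real" where
  "cop = (\<lambda>u\<in>icube d. prob {y \<in> space N. \<forall>k\<in>{1..d}. mcdf k (y k) \<le> u k})"

text \<open>An entry 1 imposes no constraint, and on \<open>K\<close> cancelling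
  \<open>mcdf k\<close> on both sides costs only a null set. Singletons \<open>K\<close> give the
  uniform margins, \<open>K = {1..d}\<close> gives Sklar's identity, and general \<open>K\<close>
  the values of \<open>margin\<close>.\<close>

lemma cop_mcdf:
  assumes "K \<subseteq> {1..d}"
  shows "cop (\<lambda>k\<in>{1..d}. if k \<in> K then mcdf k (x k) else 1) = prob {y \<in> space N. \<forall>k\<in>K. y k \<le> x k}"
proof -
  have fin: "finite K" using assms finite_subset by blast
  have [measurable]: "(\<lambda>y. y k) \<in> borel_measurable N" if "k \<in> K" for k
    using that assms by auto
  have [measurable]: "mcdf k \<in> borel_measurable borel" if "k \<in> K" for k
    using that assms by auto
  have "cop (\<lambda>k\<in>{1..d}. if k \<in> K then mcdf k (x k) else 1)
      = prob {y \<in> space N. \<forall>k\<in>{1..d}. mcdf k (y k) \<le> (if k \<in> K then mcdf k (x k) else 1)}"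
    by (auto simp: cop_def icube_def mcdf_nonneg mcdf_le_1 intro!: arg_cong[where f=prob])
  also have "\<dots> = prob {y \<in> space N. \<forall>k\<in>K. mcdf k (y k) \<le> mcdf k (x k)}"
    using assms by (intro arg_cong[where f=prob]) (auto simp: mcdf_le_1)
  also have "\<dots> = prob {y \<in> space N. \<forall>k\<in>K. y k \<le> x k}"
  proof (rule finite_measure_eq_AE)
    have "AE y in N. \<forall>k\<in>K. y k \<le> quantile k (mcdf k (x k)) \<longleftrightarrow> y k \<le> x k"
      using AE_le_quantile_mcdf assms fin by (intro AE_finite_allI) auto
    then show "AE y in N. y \<in> {y \<in> space N. \<forall>k\<in>K. mcdf k (y k) \<le> mcdf k (x k)}
        \<longleftrightarrow> y \<in> {y \<in> space N. \<forall>k\<in>K. y k \<le> x k}"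
      by eventually_elim (use mcdf_le_iff[OF _ mcdf_nonneg] assms in blast)
  qed (use fin in measurable)
  finally show ?thesis .
qed

text \<open>Quantiles serve as preimages. This surjectivity onto the cube forces the copula to be
  unique.\<close>

lemma ex_mcdf_eq:
  assumes "u \<in> icube d"
  shows "\<exists>x\<in>space (ebox_borel d). (\<lambda>k\<in>{1..d}. mcdf k (x k)) = u"
proof (intro bexI ext)
  fix k show "(\<lambda>k\<in>{1..d}. mcdf k ((\<lambda>k\<in>{1..d}. quantile k (u k)) k)) k = u k"
    using assms mcdf_quantile[of k "u k"] PiE_arb[OF assms[unfolded icube_def], of k] by (auto simp: icube_def Pi_iff PiE_iff)
qed (auto simp: space_ebox_borel)

lemma cop_quantile:
  assumes u: "u \<in> icube d"
  shows "cop u = prob {y \<in> space N. \<forall>k\<in>{1..d}. y k \<le> quantile k (u k)}"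
proof -
  have "cop u = prob {y \<in> space N. \<forall>k\<in>{1..d}. mcdf k (y k) \<le> u k}"
    using u by (simp add: cop_def)
  also have "{y \<in> space N. \<forall>k\<in>{1..d}. mcdf k (y k) \<le> u k}
      = {y \<in> space N. \<forall>k\<in>{1..d}. y k \<le> quantile k (u k)}"
    using u mcdf_le_iff by (fastforce simp: icube_def PiE_iff)
  finally show ?thesis .
qed

text \<open>The substantial axiom is nonnegativity of rectangle volumes. A volume is the integral of
  a product of differences of indicators; expanding the product gives the signed sum over the
  vertices.\<close>

lemma copula_cop: "copula d cop"
  unfolding copula_def
proof (intro conjI ballI impI)
  show "cop \<in> icube d \<rightarrow>\<^sub>E {0..1}"
    by (auto simp: cop_def)
next
  fix u assume u: "u \<in> icube d" and "\<exists>k\<in>{1..d}. u k = 0"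
  then obtain k where k: "k \<in> {1..d}" "u k = 0" by blast
  \<comment> \<open>Only the constraint on coordinate \<open>k\<close> is kept; at level 0 it
    already has probability 0.\<close>
  have "cop u \<le> mcdf k (quantile k (u k))"
    unfolding cop_quantile[OF u] mcdf_def using k(1) by (intro finite_measure_mono) auto
  also have "\<dots> = 0"
    using mcdf_quantile[OF k(1), of 0] k(2) by simp
  finally show "cop u = 0"
    using u by (simp add: cop_def measure_le_0_iff)
next
  fix u k assume u: "u \<in> icube d" and k: "k \<in> {1..d}" and "\<forall>i\<in>{1..d} - {k}. u i = 1"
  moreover have "0 \<le> u k" "u k \<le> 1" using u k by (auto simp: icube_def PiE_iff)
  \<comment> \<open>Brings \<open>u\<close> into the shape of \<open>cop_mcdf\<close> with
    \<open>K = {k}\<close>, writing the free coordinate as \<open>mcdf k\<close> of its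
    quantile.\<close>
  ultimately have "u = (\<lambda>i\<in>{1..d}. if i \<in> {k} then mcdf i (quantile k (u k)) else 1)"
    using mcdf_quantile[OF k, of "u k"] PiE_arb[OF u[unfolded icube_def]]
    by (intro ext) (auto simp: restrict_def)
  then have "cop u = cop (\<lambda>i\<in>{1..d}. if i \<in> {k} then mcdf i (quantile k (u k)) else 1)"
    by (rule arg_cong)
  also have "\<dots> = mcdf k (quantile k (u k))"
    using k cop_mcdf[of "{k}" "\<lambda>_. quantile k (u k)"] by (simp add: mcdf_def)
  also have "\<dots> = u k"
    using \<open>0 \<le> u k\<close> \<open>u k \<le> 1\<close> by (intro mcdf_quantile k)
  finally show "cop u = u k" .
next
  fix u v assume u: "u \<in> icube d" and v: "v \<in> icube d" and uv: "\<forall>i\<in>{1..d}. u i \<le> v i"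
  let ?I = "{1..d}"
  let ?w = "\<lambda>S. \<lambda>i\<in>?I. if i \<in> S then u i else v i"
  \<comment> \<open>\<open>?a\<close> and \<open>?b\<close> indicate the rays ending at the lower
    and the upper corner. The vertex \<open>?w S\<close> uses the lower corner exactly on
    \<open>S\<close>, so its value under \<open>cop\<close> is the expectation of the mixed
    product.\<close>
  let ?a = "\<lambda>y i. indicator {..quantile i (u i)} (y i) :: real"
  let ?b = "\<lambda>y i. indicator {..quantile i (v i)} (y i) :: real"
  have w: "?w S \<in> icube d" for S
    using u v by (auto simp: icube_def PiE_iff)
  have cop_w: "cop (?w S) = (\<integral>y. (\<Prod>i\<in>S. ?a y i) * (\<Prod>i\<in>?I-S. ?b y i) \<partial>N)"
    and int_w: "integrable N (\<lambda>y. (\<Prod>i\<in>S. ?a y i) * (\<Prod>i\<in>?I-S. ?b y i))" if S: "S \<subseteq> ?I" for S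
  proof -
    let ?A = "{y \<in> space N. \<forall>k\<in>?I. y k \<le> quantile k (?w S k)}"
    have ind: "indicator ?A y = (\<Prod>i\<in>S. ?a y i) * (\<Prod>i\<in>?I-S. ?b y i)" if y: "y \<in> space N" for y
    proof -
      have "(\<Prod>i\<in>S. ?a y i) * (\<Prod>i\<in>?I-S. ?b y i)
          = (\<Prod>i\<in>?I. indicator {..quantile i (?w S i)} (y i))"
        unfolding prod.subset_diff[OF S finite_atLeastAtMost]
        using S by (subst mult.commute, intro arg_cong2[where f="(*)"] prod.cong) auto
      also have "\<dots> = indicator ?A y"
      proof (cases "y \<in> ?A")
        case True
        then show ?thesis by (auto intro!: prod.neutral)
      next
        case False
        then obtain k where "k \<in> ?I" "\<not> y k \<le> quantile k (?w S k)"
          using y by blast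
        then show ?thesis
          using False by (subst prod_zero) (auto intro!: bexI[of _ k])
      qed
      finally show ?thesis by simp
    qed
    have A: "?A \<in> events" by measurable
    show "cop (?w S) = (\<integral>y. (\<Prod>i\<in>S. ?a y i) * (\<Prod>i\<in>?I-S. ?b y i) \<partial>N)"
      unfolding cop_quantile[OF w]
      using Bochner_Integration.integral_cong[OF refl ind, of N "\<lambda>y. y"] by simp
    show "integrable N (\<lambda>y. (\<Prod>i\<in>S. ?a y i) * (\<Prod>i\<in>?I-S. ?b y i))"
      by (rule Bochner_Integration.integrable_cong[OF refl ind, THEN iffD1, OF _ integrable_real_indicator[OF A]])
        (simp_all add: emeasure_eq_measure)
  qed
  have quantile_mono: "quantile i (u i) \<le> quantile i (v i)" if "i \<in> ?I" for i
    using uv that unfolding quantile_def by (intro Sup_subset_mono) fastforce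
  \<comment> \<open>Monotone quantiles nest the rays, so every factor is nonnegative.\<close>
  have "0 \<le> (\<integral>y. (\<Prod>i\<in>?I. ?b y i - ?a y i) \<partial>N)"
    using quantile_mono order_trans
    by (intro Bochner_Integration.integral_nonneg prod_nonneg) (fastforce simp: indicator_def)
  also have "\<dots> = (\<integral>y. (\<Sum>S\<in>Pow ?I. (-1) ^ card S * ((\<Prod>i\<in>S. ?a y i) * (\<Prod>i\<in>?I-S. ?b y i))) \<partial>N)"
    by (subst prod_diff_conv_sum) (auto simp: mult.assoc)
  also have "\<dots> = (\<Sum>S\<in>Pow ?I. (-1) ^ card S * cop (?w S))"
    using int_w cop_w by (subst Bochner_Integration.integral_sum) (auto intro!: sum.cong)
  finally show "0 \<le> (\<Sum>S\<in>Pow ?I. (-1) ^ card S * cop (?w S))" .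
qed

text \<open>Two candidates agree on the cube, where every point is a vector of marginal values, and
  off the cube, where extensionality makes both \<open>undefined\<close>.\<close>

lemma order_transform_eq_cop:
  assumes "\<And>x. x \<in> space (ebox_borel d) \<Longrightarrow> order_dist d C x = dist_fun d N x"
  shows "order_transform d C = cop"
proof -
  have margin: "dist_margin d (order_dist d C) k t = mcdf k t" if "k \<in> {1..d}" for k t
  proof -
    have "dist_margin d (order_dist d C) k t = dist_fun d N (\<lambda>i\<in>{1..d}. if i = k then t else \<infinity>)"
      unfolding dist_margin_def by (rule assms) (auto simp: space_ebox_borel)
    also have "\<dots> = mcdf k t"
      unfolding dist_fun_def mcdf_def using that
      by (intro arg_cong[where f=prob]) (auto simp: space_N space_ebox_borel)
    finally show ?thesis .
  qed
  have margins: "(\<lambda>k\<in>{1..d}. dist_margin d (order_dist d C) k (x k)) = (\<lambda>k\<in>{1..d}. mcdf k (x k))" for x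
    using margin by auto
  have sklar: "order_dist d C x = cop (\<lambda>k\<in>{1..d}. mcdf k (x k))" if "x \<in> space (ebox_borel d)" for x
  proof -
    have "cop (\<lambda>k\<in>{1..d}. mcdf k (x k)) = cop (\<lambda>k\<in>{1..d}. if k \<in> {1..d} then mcdf k (x k) else 1)"
      by (intro arg_cong[where f=cop]) auto
    also have "\<dots> = order_dist d C x"
      unfolding assms[OF that] by (subst cop_mcdf) (auto simp: dist_fun_def space_N space_ebox_borel)
    finally show ?thesis by simp
  qed
  show ?thesis
    unfolding order_transform_def margins
  proof (rule the_equality)
    fix D assume D: "copula d D \<and>
      (\<forall>x\<in>space (ebox_borel d). order_dist d C x = D (\<lambda>k\<in>{1..d}. mcdf k (x k)))"
    show "D = cop"
    proof
      fix u show "D u = cop u"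
      proof (cases "u \<in> icube d")
        case True
        then obtain x where "x \<in> space (ebox_borel d)" "(\<lambda>k\<in>{1..d}. mcdf k (x k)) = u"
          using ex_mcdf_eq by blast
        then show ?thesis using D sklar by metis
      next
        case False
        then show ?thesis
          using D copula_cop PiE_arb unfolding copula_def by metis
      qed
    qed
  qed (use copula_cop sklar in blast)
qed

text \<open>The measure of the margin is the law of the transforms \<open>mcdf k (y k)\<close> for
  \<open>k \<in> K\<close>, renumbered. Pulling the integral back to \<open>N\<close> and applying
  \<open>cop_mcdf\<close> leaves the probability that an independent copy is dominated on
  \<open>K\<close>.\<close>

lemma bracket_margin_cop:
  assumes K: "K \<subseteq> {1..d}"
  shows "bracket (card K) (margin d K cop) (margin d K cop)
       = (\<integral>x. prob {y \<in> space N. \<forall>k\<in>K. y k \<le> x k} \<partial>N)"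
proof -
  have fin: "finite K" using K finite_subset by blast
  define n where "n = card K"
  \<comment> \<open>The position of \<open>i\<close> in the increasing enumeration of
    \<open>K\<close>, as in \<open>margin_embed\<close>; the inverse \<open>e\<close> below lists
    the elements of \<open>K\<close>.\<close>
  define r where "r i = card {k \<in> K. k \<le> i}" for i
  have r: "bij_betw r K {1..n}"
  proof -
    have inj: "inj_on r K"
    proof (rule linorder_inj_onI)
      fix i j assume "i < j" "i \<in> K" "j \<in> K"
      then have "{k \<in> K. k \<le> i} \<subseteq> {k \<in> K. k \<le> j}" "j \<in> {k \<in> K. k \<le> j} - {k \<in> K. k \<le> i}"
        by auto
      then have "r i < r j"
        unfolding r_def using fin by (intro psubset_card_mono) auto
      then show "r i \<noteq> r j" by simp
    qed auto
    have "r i \<in> {1..n}" if "i \<in> K" for i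
    proof -
      have "{k \<in> K. k \<le> i} \<noteq> {}" using that by auto
      then show ?thesis
        using fin unfolding r_def n_def by (auto simp: Suc_le_eq card_gt_0_iff intro!: card_mono)
    qed
    then have "r ` K = {1..n}"
      using card_image[OF inj] by (intro card_subset_eq) (auto simp: n_def)
    then show ?thesis using inj by (simp add: bij_betw_def)
  qed
  define e where "e = inv_into K r"
  have e: "e j \<in> K" "r (e j) = j" if "j \<in> {1..n}" for j
    using r that unfolding e_def by (auto simp: bij_betw_def inv_into_into f_inv_into_f)
  have er: "e (r i) = i" "r i \<in> {1..n}" if "i \<in> K" for i
    using r that unfolding e_def by (auto simp: bij_betw_def)
  define V where "V y = (\<lambda>j\<in>{1..n}. mcdf (e j) (y (e j)))" for y
  have V: "V y \<in> icube n" for y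
    by (auto simp: V_def icube_def mcdf_nonneg mcdf_le_1)
  have V_measurable [measurable]: "V \<in> measurable N (icube_borel n)"
    unfolding V_def icube_borel_def
  proof (rule measurable_restrict)
    fix j assume "j \<in> {1..n}"
    then have j [measurable]: "e j \<in> {1..d}" using e(1) K by blast
    show "(\<lambda>y. mcdf (e j) (y (e j))) \<in> measurable N (restrict_space borel {0..1})"
      by (rule measurable_restrict_space2) (auto simp: mcdf_nonneg mcdf_le_1)
  qed
  have embed: "margin_embed d K v = (\<lambda>i\<in>{1..d}. if i \<in> K then v (r i) else 1)" for v
    by (simp only: margin_embed_def r_def)
  have embed_icube: "margin_embed d K v \<in> icube d" if "v \<in> icube n" for v
    using that er(2) unfolding embed icube_def by (auto simp: PiE_iff)
  have embed_V: "margin_embed d K (V x) = (\<lambda>i\<in>{1..d}. if i \<in> K then mcdf i (x i) else 1)" for x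
    unfolding embed V_def using er by auto
  have Q: "copula_measure n (margin d K cop) = distr N (icube_borel n) V"
  proof (rule copula_measure_eqI)
    show "prob_space (distr N (icube_borel n) V)"
      by (rule prob_space_distr) measurable
    fix u assume u: "u \<in> icube n"
    let ?B = "{v \<in> icube n. \<forall>i\<in>{1..n}. v i \<le> u i}"
    have "?B = Pi\<^sub>E {1..n} (\<lambda>i. {0..1} \<inter> {..u i})"
      by (auto simp: icube_def PiE_iff extensional_def)
    also have "\<dots> \<in> sets (icube_borel n)"
      unfolding icube_borel_def by (intro sets_PiM_I_finite) (auto simp: sets_restrict_space)
    finally have B: "?B \<in> sets (icube_borel n)" .
    have "measure (distr N (icube_borel n) V) ?B = prob (V -` ?B \<inter> space N)"
      by (rule measure_distr[OF V_measurable B])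
    also have "V -` ?B \<inter> space N = {y \<in> space N. \<forall>k\<in>{1..d}. mcdf k (y k) \<le> margin_embed d K u k}"
    proof -
      have "(\<forall>j\<in>{1..n}. mcdf (e j) (y (e j)) \<le> u j) \<longleftrightarrow> (\<forall>k\<in>K. mcdf k (y k) \<le> u (r k))" for y
        using e er by metis
      also have "(\<forall>k\<in>K. mcdf k (y k) \<le> u (r k))
          \<longleftrightarrow> (\<forall>k\<in>{1..d}. mcdf k (y k) \<le> margin_embed d K u k)" for y
        unfolding embed using K by (auto simp: mcdf_le_1)
      finally show ?thesis using V by (auto simp: V_def)
    qed
    also have "prob \<dots> = margin d K cop u"
      using u embed_icube[OF u] by (simp add: margin_def cop_def n_def)
    finally show "measure (distr N (icube_borel n) V) ?B = margin d K cop u" .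
  qed simp
  have margin_V: "margin d K cop (V x) = prob {y \<in> space N. \<forall>k\<in>K. y k \<le> x k}" for x
    using V[of x] cop_mcdf[OF K, of x] by (simp add: margin_def n_def embed_V)
  have margin_measurable: "margin d K cop \<in> borel_measurable (icube_borel n)"
  proof -
    have [measurable]: "(\<lambda>v. v j) \<in> borel_measurable (icube_borel n)" if "j \<in> {1..n}" for j
    proof -
      have "(\<lambda>v. v j) \<in> measurable (icube_borel n) (restrict_space borel {0..1})"
        unfolding icube_borel_def using that by measurable
      then show ?thesis by (simp add: measurable_restrict_space2_iff)
    qed
    have [measurable]: "k \<in> {1..d}" "r k \<in> {1..n}" if "k \<in> K" for k
      using that K er by auto
    note [measurable] = \<open>finite K\<close>
    let ?P = "\<lambda>v y. \<forall>k\<in>K. mcdf k (y k) \<le> v (r k)"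
    \<comment> \<open>Measurability in \<open>v\<close> comes from writing the margin as a parameter
      integral of a jointly measurable indicator.\<close>
    have "(\<lambda>v. \<integral>y. (if ?P v y then 1 else 0 :: real) \<partial>N) \<in> borel_measurable (icube_borel n)"
      by (rule borel_measurable_lebesgue_integral) measurable
    moreover have "margin d K cop v = (\<integral>y. (if ?P v y then 1 else 0) \<partial>N)" if "v \<in> icube n" for v
    proof -
      have "margin d K cop v = prob {y \<in> space N. \<forall>k\<in>{1..d}. mcdf k (y k) \<le> margin_embed d K v k}"
        using that embed_icube[OF that] by (simp add: margin_def cop_def n_def)
      also have "{y \<in> space N. \<forall>k\<in>{1..d}. mcdf k (y k) \<le> margin_embed d K v k} = {y \<in> space N. ?P v y}"
        unfolding embed using K by (auto simp: mcdf_le_1)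
      also have "prob \<dots> = (\<integral>y. indicator {y \<in> space N. ?P v y} y \<partial>N)"
        by simp
      also have "\<dots> = (\<integral>y. (if ?P v y then 1 else 0) \<partial>N)"
        by (intro Bochner_Integration.integral_cong) (auto simp: indicator_def)
      finally show ?thesis .
    qed
    ultimately show ?thesis
      by (subst measurable_cong) (auto simp: space_icube_borel)
  qed
  show ?thesis
    unfolding bracket_def n_def[symmetric] Q
    by (subst integral_distr[OF V_measurable margin_measurable]) (simp add: margin_V)
qed

end

section \<open>Order statistics of independent uniform variables\<close>

text \<open>The maximum over \<open>J\<close> is at most \<open>t\<close> exactly when
  \<open>J\<close> lies in the sublevel set of \<open>t\<close>, and a \<open>k\<close>-element
  \<open>J\<close> of this kind exists exactly when that set has at least \<open>k\<close> elements.
  Counting serves measurability and reflection; membership in the image serves the absence of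
  atoms.\<close>

lemma
  assumes k: "k \<in> {1..d}"
  shows order_map_le_iff: "order_map d x k \<le> t \<longleftrightarrow> k \<le> card {i \<in> {1..d}. x i \<le> t}" (is ?le)
    and order_map_less_iff: "order_map d x k < t \<longleftrightarrow> k \<le> card {i \<in> {1..d}. x i < t}" (is ?less)
    and order_map_in_image: "order_map d x k \<in> x ` {1..d}" (is ?mem)
proof -
  let ?S = "{Max (x ` J) | J. J \<subseteq> {1..d} \<and> card J = k}"
  have S: "order_map d x k = Min ?S" using k by (simp add: order_map_def)
  have "?S = (\<lambda>J. Max (x ` J)) ` {J. J \<subseteq> {1..d} \<and> card J = k}" by auto
  then have fin: "finite ?S" by (simp add: finite_subset[of _ "Pow {1..d}"])
  have "?S \<noteq> {}"
    using k obtain_subset_with_card_n[of k "{1..d}"] by auto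
  note S_facts = fin this
  have J: "finite (x ` J)" "x ` J \<noteq> {}" if "J \<subseteq> {1..d}" "card J = k" for J
    using that k finite_subset[of J "{1..d}"] by auto
  have ex: "(\<exists>J. J \<subseteq> {1..d} \<and> card J = k \<and> (\<forall>l\<in>J. P l)) \<longleftrightarrow> k \<le> card {i \<in> {1..d}. P i}" for P
  proof
    assume "\<exists>J. J \<subseteq> {1..d} \<and> card J = k \<and> (\<forall>l\<in>J. P l)"
    then show "k \<le> card {i \<in> {1..d}. P i}"
      by (auto intro!: card_mono)
  next
    assume "k \<le> card {i \<in> {1..d}. P i}"
    then obtain J where "J \<subseteq> {i \<in> {1..d}. P i}" "card J = k"
      using obtain_subset_with_card_n by metis
    then show "\<exists>J. J \<subseteq> {1..d} \<and> card J = k \<and> (\<forall>l\<in>J. P l)" by blast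
  qed
  have "order_map d x k \<le> t \<longleftrightarrow> (\<exists>J. J \<subseteq> {1..d} \<and> card J = k \<and> Max (x ` J) \<le> t)"
    unfolding S Min_le_iff[OF S_facts] by blast
  also have "\<dots> \<longleftrightarrow> (\<exists>J. J \<subseteq> {1..d} \<and> card J = k \<and> (\<forall>l\<in>J. x l \<le> t))"
    using Max_le_iff[OF J] by (intro iff_exI conj_cong refl) simp
  finally show ?le unfolding ex .
  have "order_map d x k < t \<longleftrightarrow> (\<exists>J. J \<subseteq> {1..d} \<and> card J = k \<and> Max (x ` J) < t)"
    unfolding S Min_less_iff[OF S_facts] by blast
  also have "\<dots> \<longleftrightarrow> (\<exists>J. J \<subseteq> {1..d} \<and> card J = k \<and> (\<forall>l\<in>J. x l < t))"
    using Max_less_iff[OF J] by (intro iff_exI conj_cong refl) simp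
  finally show ?less unfolding ex .
  have "order_map d x k \<in> ?S"
    unfolding S by (rule Min_in[OF S_facts])
  then obtain J0 where J0: "J0 \<subseteq> {1..d}" "card J0 = k" and "order_map d x k = Max (x ` J0)" by blast
  then have "order_map d x k \<in> x ` J0" using Max_in[OF J[OF J0]] by simp
  then show ?mem using J0(1) by blast
qed

section \<open>Reflection and measurability of the order map\<close>

lemma one_minus_ereal_le_iff: "1 - x \<le> t \<longleftrightarrow> 1 - t \<le> (x :: ereal)"
  by (cases x; cases t) (auto simp: one_ereal_def)

lemma one_minus_ereal_le_cancel: "1 - x \<le> 1 - y \<longleftrightarrow> y \<le> (x :: ereal)"
  by (cases x; cases y) (auto simp: one_ereal_def)

lemma reflect_index_in: "k \<in> {1..d} \<Longrightarrow> reflect_index d k \<in> {1..d}"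
  and reflect_index_idem: "k \<in> {1..d} \<Longrightarrow> reflect_index d (reflect_index d k) = k"
  by (auto simp: reflect_index_def)

text \<open>Counting reflected values up to \<open>t\<close> is counting original values from
  \<open>1 - t\<close> on, which complements the count strictly below \<open>1 - t\<close>. Both
  sides then have the same upper bounds.\<close>

lemma order_map_reflect:
  assumes k: "k \<in> {1..d}"
  shows "order_map d (\<lambda>i\<in>{1..d}. 1 - x i) k = 1 - order_map d x (reflect_index d k)"
proof -
  have "order_map d (\<lambda>i\<in>{1..d}. 1 - x i) k \<le> t \<longleftrightarrow> 1 - order_map d x (reflect_index d k) \<le> t" for t
  proof -
    let ?A = "{i \<in> {1..d}. x i < 1 - t}" and ?B = "{i \<in> {1..d}. 1 - t \<le> x i}"
    have "card ?A + card ?B = card (?A \<union> ?B)"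
      by (rule card_Un_disjoint[symmetric]) auto
    also have "?A \<union> ?B = {1..d}" by auto
    finally have AB: "card ?A + card ?B = d" by simp
    have "order_map d (\<lambda>i\<in>{1..d}. 1 - x i) k \<le> t
        \<longleftrightarrow> k \<le> card {i \<in> {1..d}. (\<lambda>i\<in>{1..d}. 1 - x i) i \<le> t}"
      by (rule order_map_le_iff[OF k])
    also have "{i \<in> {1..d}. (\<lambda>i\<in>{1..d}. 1 - x i) i \<le> t} = ?B"
      by (auto simp: one_minus_ereal_le_iff)
    \<comment> \<open>The counts sum to \<open>d\<close>, so \<open>k \<le> card ?B\<close> means
      \<open>card ?A < d - k + 1\<close>; this is the shift by one in
      \<open>reflect_index\<close>.\<close>
    also have "k \<le> card ?B \<longleftrightarrow> \<not> reflect_index d k \<le> card ?A"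
      using AB k by (auto simp: reflect_index_def)
    also have "\<dots> \<longleftrightarrow> \<not> order_map d x (reflect_index d k) < 1 - t"
      using order_map_less_iff[OF reflect_index_in[OF k]] by simp
    also have "\<dots> \<longleftrightarrow> 1 - order_map d x (reflect_index d k) \<le> t"
      by (simp add: one_minus_ereal_le_iff not_less)
    finally show ?thesis .
  qed
  then show ?thesis by (meson antisym order_refl)
qed

lemma measurable_order_map: "order_map d \<in> measurable (ebox_borel d) (ebox_borel d)"
proof -
  have comp [measurable]: "(\<lambda>y. y k) \<in> borel_measurable (ebox_borel d)" if "k \<in> {1..d}" for k
    using that unfolding ebox_borel_def by measurable
  have "(\<lambda>x. \<lambda>k\<in>{1..d}. order_map d x k) \<in> measurable (ebox_borel d) (ebox_borel d)"
    unfolding ebox_borel_def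
  proof (rule measurable_restrict, fold ebox_borel_def, rule borel_measurableI_le)
    fix k t assume k: "k \<in> {1..d}"
    \<comment> \<open>As a finite sum of measurable terms, the count makes the sublevel sets
      measurable.\<close>
    have "card {i \<in> {1..d}. x i \<le> t} = (\<Sum>i\<in>{1..d}. if x i \<le> t then 1 else 0)" for x :: "nat \<Rightarrow> ereal"
      by (simp add: sum.If_cases Int_def)
    then have "{x \<in> space (ebox_borel d). order_map d x k \<le> t}
        = {x \<in> space (ebox_borel d). k \<le> (\<Sum>i\<in>{1..d}. if x i \<le> t then 1 else 0)}"
      using order_map_le_iff[OF k] by simp
    also have "\<dots> \<in> sets (ebox_borel d)"
      by measurable
    finally show "{x \<in> space (ebox_borel d). order_map d x k \<le> t} \<in> sets (ebox_borel d)" .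
  qed
  moreover have "(\<lambda>k\<in>{1..d}. order_map d x k) = order_map d x" for x
    by (auto simp: order_map_def)
  ultimately show ?thesis by simp
qed

section \<open>The uniform law on the extended line and its powers\<close>

definition unif :: "ereal measure" where
  "unif = distr (uniform_measure lborel {0..1}) borel ereal"

lemma sets_unif [simp, measurable_cong]: "sets unif = sets borel"
  and space_unif [simp]: "space unif = UNIV"
  by (simp_all add: unif_def)

lemma prob_space_unif: "prob_space unif"
  unfolding unif_def
  by (intro prob_space.prob_space_distr prob_space_uniform_measure) auto

lemma measure_unif:
  assumes "A \<in> sets borel"
  shows "measure unif A = measure lborel ({0..1} \<inter> ereal -` A)"
proof -
  have "ereal -` A \<in> sets lborel"
    using measurable_sets[OF borel_measurable_ereal[OF measurable_ident] assms] by simp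
  then show ?thesis
    using assms by (simp add: unif_def measure_distr measure_uniform_measure)
qed

lemma measure_unif_atMost: "measure unif {..t} = clip t"
proof (cases t)
  case (real r)
  have "{0..1} \<inter> ereal -` {..t} = {0..min r 1}" using real by auto
  then show ?thesis
    using real by (simp add: measure_unif clip_def one_ereal_def zero_ereal_def max_def min_def)
next
  case PInf
  have "{0..1} \<inter> ereal -` {..t} = {0..1}" using PInf by auto
  then show ?thesis
    using PInf by (simp add: measure_unif clip_def)
next
  case MInf
  have "{0..1} \<inter> ereal -` {..t} = {}" using MInf by (auto simp: one_ereal_def)
  then show ?thesis using MInf by (simp add: measure_unif clip_def)
qed

text \<open>The ray is the preimage of \<open>{..t}\<close> under \<open>x \<mapsto> 1 - x\<close>,
  so this is invariance of \<open>unif\<close> under reflection, in the form used for boxes.\<close>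

lemma measure_unif_atLeast: "measure unif {1 - t..} = clip t"
proof (cases t)
  case (real r)
  have "{0..1} \<inter> ereal -` {1 - t..} = {max 0 (1 - r)..1}" using real by (auto simp: one_ereal_def)
  then show ?thesis
    using real by (simp add: measure_unif clip_def one_ereal_def zero_ereal_def max_def min_def)
next
  case PInf
  have "{0..1} \<inter> ereal -` {1 - t..} = {0..1}" using PInf by (auto simp: one_ereal_def)
  then show ?thesis
    using PInf by (simp add: measure_unif clip_def)
next
  case MInf
  have "{0..1} \<inter> ereal -` {1 - t..} = {}" using MInf by (auto simp: one_ereal_def)
  then show ?thesis using MInf by (simp add: measure_unif clip_def)
qed

lemma measure_unif_singleton: "measure unif {t} = 0"
proof -
  have "{0..1} \<inter> ereal -` {t} \<subseteq> {real_of_ereal t}"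
    by (rule subsetI) (simp, metis real_of_ereal.simps(1))
  then have "countable ({0..1} \<inter> ereal -` {t})"
    by (rule countable_subset) simp
  then have "emeasure lborel ({0..1} \<inter> ereal -` {t}) = 0"
    by (rule emeasure_lborel_countable)
  then show ?thesis
    by (subst measure_unif) (auto simp only: measure_def enn2real_0 borel_singleton sets.empty_sets)
qed

definition indep_unif :: "nat \<Rightarrow> (nat \<Rightarrow> ereal) measure" where
  "indep_unif d = PiM {1..d} (\<lambda>_. unif)"

lemma sets_indep_unif [measurable_cong]: "sets (indep_unif d) = sets (ebox_borel d)"
  unfolding indep_unif_def ebox_borel_def by (intro sets_PiM_cong) auto

lemma space_indep_unif: "space (indep_unif d) = {1..d} \<rightarrow>\<^sub>E UNIV"
  by (simp add: indep_unif_def space_PiM)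

lemma prob_space_indep_unif: "prob_space (indep_unif d)"
  unfolding indep_unif_def by (intro prob_space_PiM prob_space_unif)

lemma measure_indep_unif_PiE:
  assumes "\<And>i. i \<in> {1..d} \<Longrightarrow> A i \<in> sets borel"
  shows "measure (indep_unif d) (Pi\<^sub>E {1..d} A) = (\<Prod>i\<in>{1..d}. measure unif (A i))"
proof -
  interpret unif: prob_space unif by (rule prob_space_unif)
  interpret finite_product_prob_space "\<lambda>_. unif" "{1..d}"
    by unfold_locales auto
  show ?thesis
    unfolding indep_unif_def using assms by (intro prob_times) auto
qed

lemma dist_fun_indep_unif: "dist_fun d (indep_unif d) x = (\<Prod>i\<in>{1..d}. clip (x i))"
proof -
  have "{y \<in> space (ebox_borel d). \<forall>i\<in>{1..d}. y i \<le> x i} = Pi\<^sub>E {1..d} (\<lambda>i. {..x i})"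
    by (auto simp: space_ebox_borel PiE_iff extensional_def)
  then show ?thesis
    unfolding dist_fun_def by (simp only: measure_indep_unif_PiE[OF atMost_borel] measure_unif_atMost)
qed

lemma clip_bounds: "0 \<le> clip x" "clip x \<le> 1"
  by (cases x; simp add: clip_def one_ereal_def zero_ereal_def max_def min_def)+

text \<open>Both distribution functions are products of \<open>clip\<close> values;
  \<open>clip_bounds\<close> places the clipped vector in the cube, where
  \<open>product_copula\<close> is the product.\<close>

lemma dist_measure_product_copula:
  "dist_measure d (copula_extension d (product_copula d)) = indep_unif d"
  by (rule dist_measure_eqI)
     (auto simp: prob_space_indep_unif sets_indep_unif dist_fun_indep_unif copula_extension_def
       product_copula_def icube_def clip_bounds)

lemma measurable_reflect: "(\<lambda>y. \<lambda>i\<in>{1..d}. 1 - y i) \<in> measurable (ebox_borel d) (ebox_borel d)"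
  unfolding ebox_borel_def by measurable

text \<open>A lower box pulls back to an upper box whose sides have the same \<open>unif\<close>
  measure, and distribution functions determine the law.\<close>

lemma distr_reflect_indep_unif:
  "distr (indep_unif d) (ebox_borel d) (\<lambda>y. \<lambda>i\<in>{1..d}. 1 - y i) = indep_unif d"
proof (rule ebox_measure_eqI)
  have R [measurable]: "(\<lambda>y. \<lambda>i\<in>{1..d}. 1 - y i) \<in> measurable (indep_unif d) (ebox_borel d)"
    using measurable_reflect by (simp add: measurable_cong_sets[OF sets_indep_unif refl])
  show "prob_space (distr (indep_unif d) (ebox_borel d) (\<lambda>y. \<lambda>i\<in>{1..d}. 1 - y i))"
    by (intro prob_space.prob_space_distr prob_space_indep_unif) measurable
  fix x
  let ?B = "{y \<in> space (ebox_borel d). \<forall>i\<in>{1..d}. y i \<le> x i}"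
  have B: "?B \<in> sets (ebox_borel d)"
    unfolding ebox_borel_def by measurable
  have "(\<lambda>y. \<lambda>i\<in>{1..d}. 1 - y i) -` ?B \<inter> space (indep_unif d) = Pi\<^sub>E {1..d} (\<lambda>i. {1 - x i..})"
    by (auto simp: space_ebox_borel space_indep_unif PiE_iff extensional_def one_minus_ereal_le_iff)
  then have "dist_fun d (distr (indep_unif d) (ebox_borel d) (\<lambda>y. \<lambda>i\<in>{1..d}. 1 - y i)) x
      = measure (indep_unif d) (Pi\<^sub>E {1..d} (\<lambda>i. {1 - x i..}))"
    unfolding dist_fun_def by (simp only: measure_distr[OF R B])
  also have "\<dots> = dist_fun d (indep_unif d) x"
    by (subst measure_indep_unif_PiE) (auto simp: measure_unif_atLeast dist_fun_indep_unif)
  finally show "dist_fun d (distr (indep_unif d) (ebox_borel d) (\<lambda>y. \<lambda>i\<in>{1..d}. 1 - y i)) x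
      = dist_fun d (indep_unif d) x" .
qed (simp_all add: sets_indep_unif prob_space_indep_unif)

section \<open>The law of the order statistics\<close>

definition order_stats :: "nat \<Rightarrow> (nat \<Rightarrow> ereal) measure" where
  "order_stats d = distr (indep_unif d) (ebox_borel d) (order_map d)"

lemma measurable_order_map_indep_unif [measurable]:
  "order_map d \<in> measurable (indep_unif d) (ebox_borel d)"
  using measurable_order_map by (simp add: measurable_cong_sets[OF sets_indep_unif refl])

lemma sets_order_stats [measurable_cong]: "sets (order_stats d) = sets (ebox_borel d)"
  by (simp add: order_stats_def)

lemma measurable_component_ebox: "k \<in> {1..d} \<Longrightarrow> (\<lambda>y. y k) \<in> borel_measurable (ebox_borel d)"
  unfolding ebox_borel_def by measurable

text \<open>Each order statistic equals one of the coordinates, so it hits \<open>t\<close> only on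
  a finite union of null hyperplanes.\<close>

lemma atomless_margins_order_stats: "atomless_margins (order_stats d) d"
proof -
  interpret M: prob_space "indep_unif d" by (rule prob_space_indep_unif)
  interpret N: prob_space "order_stats d"
    unfolding order_stats_def by (rule M.prob_space_distr) measurable
  show ?thesis
  proof
    fix k t assume k: "k \<in> {1..d}"
    note [measurable] = measurable_component_ebox
    have comp: "{x \<in> space (indep_unif d). x i = t} \<in> M.events" if "i \<in> {1..d}" for i
      using that by measurable
    have atom: "M.prob {x \<in> space (indep_unif d). x i = t} = 0" if i: "i \<in> {1..d}" for i
    proof -
      \<comment> \<open>The hyperplane is a box with one degenerate side, whose factor in the
        product is 0.\<close>
      have "{x \<in> space (indep_unif d). x i = t} = Pi\<^sub>E {1..d} (\<lambda>j. if j = i then {t} else UNIV)"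
        using i by (auto simp: space_indep_unif PiE_iff extensional_def split: if_splits)
      then have "M.prob {x \<in> space (indep_unif d). x i = t}
          = (\<Prod>j\<in>{1..d}. measure unif (if j = i then {t} else UNIV))"
        by (simp only:) (rule measure_indep_unif_PiE, simp)
      also have "\<dots> = 0"
        using i by (intro prod_zero) (auto intro!: bexI[of _ i] simp: measure_unif_singleton)
      finally show ?thesis .
    qed
    have A: "{y \<in> space (ebox_borel d). y k = t} \<in> sets (ebox_borel d)"
      using k by measurable
    have "N.prob {y \<in> space (order_stats d). y k = t}
        = M.prob (order_map d -` {y \<in> space (ebox_borel d). y k = t} \<inter> space (indep_unif d))"
      unfolding order_stats_def space_distr
      by (rule measure_distr[OF measurable_order_map_indep_unif A])
    also have "\<dots> \<le> M.prob (\<Union>i\<in>{1..d}. {x \<in> space (indep_unif d). x i = t})"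
    proof (rule M.finite_measure_mono)
      show "order_map d -` {y \<in> space (ebox_borel d). y k = t} \<inter> space (indep_unif d)
          \<subseteq> (\<Union>i\<in>{1..d}. {x \<in> space (indep_unif d). x i = t})"
      proof
        fix x assume x: "x \<in> order_map d -` {y \<in> space (ebox_borel d). y k = t} \<inter> space (indep_unif d)"
        then have "t \<in> x ` {1..d}" using order_map_in_image[OF k, of x] by simp
        then show "x \<in> (\<Union>i\<in>{1..d}. {x \<in> space (indep_unif d). x i = t})" using x by blast
      qed
    qed (use comp in auto)
    also have "\<dots> \<le> (\<Sum>i\<in>{1..d}. M.prob {x \<in> space (indep_unif d). x i = t})"
      using comp by (intro M.finite_measure_subadditive_finite) auto
    also have "\<dots> = 0" using atom by simp
    finally show "N.prob {y \<in> space (order_stats d). y k = t} = 0"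
      by (simp add: measure_le_0_iff)
  qed (rule sets_order_stats)
qed

lemma measurable_reflect_order:
  "(\<lambda>y. \<lambda>k\<in>{1..d}. 1 - y (reflect_index d k)) \<in> measurable (ebox_borel d) (ebox_borel d)"
proof -
  have [measurable]: "(\<lambda>y. y (reflect_index d k)) \<in> borel_measurable (ebox_borel d)" if "k \<in> {1..d}" for k
    using measurable_component_ebox[OF reflect_index_in[OF that]] .
  show ?thesis
    by (subst (2) ebox_borel_def) measurable
qed

text \<open>Reflecting before ordering equals ordering, then reflecting with indices reversed. The
  invariance of \<open>indep_unif d\<close> therefore passes to the image law.\<close>

lemma distr_reflect_order_stats:
  "distr (order_stats d) (ebox_borel d) (\<lambda>y. \<lambda>k\<in>{1..d}. 1 - y (reflect_index d k)) = order_stats d"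
proof -
  let ?R = "\<lambda>y :: nat \<Rightarrow> ereal. \<lambda>i\<in>{1..d}. 1 - y i"
  let ?R' = "\<lambda>y :: nat \<Rightarrow> ereal. \<lambda>k\<in>{1..d}. 1 - y (reflect_index d k)"
  have R: "?R \<in> measurable (indep_unif d) (ebox_borel d)"
    using measurable_reflect by (simp only: measurable_cong_sets[OF sets_indep_unif refl])
  have "?R' (order_map d x) = order_map d (?R x)" for x
  proof
    fix k
    \<comment> \<open>For \<open>k\<close> outside \<open>{1..d}\<close> both sides are
      \<open>undefined\<close>.\<close>
    show "?R' (order_map d x) k = order_map d (?R x) k"
      using order_map_reflect[of k d x] by (cases "k \<in> {1..d}") (auto simp: order_map_def)
  qed
  then have "?R' \<circ> order_map d = order_map d \<circ> ?R" by (simp add: fun_eq_iff)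
  then have "distr (order_stats d) (ebox_borel d) ?R'
      = distr (indep_unif d) (ebox_borel d) (order_map d \<circ> ?R)"
    unfolding order_stats_def
    by (simp only: distr_distr[OF measurable_reflect_order measurable_order_map_indep_unif])
  also have "\<dots> = distr (distr (indep_unif d) (ebox_borel d) ?R) (ebox_borel d) (order_map d)"
    by (rule distr_distr[OF measurable_order_map R, symmetric])
  also have "\<dots> = order_stats d"
    by (simp only: distr_reflect_indep_unif order_stats_def)
  finally show ?thesis .
qed

text \<open>Replaces the nested definite descriptions by the concrete \<open>cop\<close> of the
  order statistics.\<close>

lemma order_transform_product_copula:
  "order_transform d (product_copula d) = atomless_margins.cop (order_stats d) d"
  by (rule atomless_margins.order_transform_eq_cop[OF atomless_margins_order_stats])
     (simp add: order_dist_def dist_measure_product_copula order_stats_def)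

section \<open>Reflection and exchange in the bracket\<close>

lemma measurable_dominance:
  assumes "finite K" "\<And>k. k \<in> K \<Longrightarrow> f k \<in> borel_measurable M"
    "\<And>k. k \<in> K \<Longrightarrow> g k \<in> borel_measurable M"
  shows "Measurable.pred M (\<lambda>x. \<forall>k\<in>K. f k x \<le> (g k x :: ereal))"
  using assms by measurable

lemma bracket_reflect:
  assumes K: "K \<subseteq> {1..d}"
  defines "C \<equiv> order_transform d (product_copula d)"
  shows "bracket (card (reflect_index d ` K)) (margin d (reflect_index d ` K) C) (margin d (reflect_index d ` K) C)
       = bracket (card K) (margin d K C) (margin d K C)"
proof -
  interpret N: atomless_margins "order_stats d" d by (rule atomless_margins_order_stats)
  interpret NN: pair_prob_space "order_stats d" "order_stats d" ..
  let ?N = "order_stats d"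
  let ?b = "reflect_index d"
  let ?R = "\<lambda>y :: nat \<Rightarrow> ereal. \<lambda>k\<in>{1..d}. 1 - y (?b k)"
  have fin: "finite K" using K finite_subset by blast
  have bK: "?b ` K \<subseteq> {1..d}" using K reflect_index_in by blast
  have R: "?R \<in> measurable ?N (ebox_borel d)"
    using measurable_reflect_order by (simp only: measurable_cong_sets[OF sets_order_stats refl])
  have space: "space ?N = space (ebox_borel d)"
    by (rule sets_eq_imp_space_eq) (rule sets_order_stats)
  have comp: "(\<lambda>y. y k) \<in> borel_measurable ?N" if "k \<in> {1..d}" for k
    using that by (rule N.measurable_component)
  \<comment> \<open>Coordinate \<open>?b k\<close> of a reflected point is one minus coordinate
    \<open>k\<close>, so the inequality turns round.\<close>
  have R_le: "?R y (?b k) \<le> ?R x (?b k) \<longleftrightarrow> x k \<le> y k" if "k \<in> K" for k x y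
  proof -
    have "k \<in> {1..d}" using that K by blast
    then show ?thesis
      using reflect_index_in[of k d] reflect_index_idem[of k d] one_minus_ereal_le_cancel by auto
  qed
  \<comment> \<open>Probabilities become integrals, so that Fubini applies to the iterated
    expression.\<close>
  have ind: "N.prob {y \<in> space ?N. P y} = (\<integral>y. (if P y then 1 else 0) \<partial>?N)" for P
  proof -
    have "(\<integral>y. (if P y then 1 else 0) \<partial>?N) = (\<integral>y. indicator {y \<in> space ?N. P y} y \<partial>?N)"
      by (intro Bochner_Integration.integral_cong) auto
    also have "\<dots> = N.prob {y \<in> space ?N. P y}" by (simp add: Int_absorb2 subset_iff)
    finally show ?thesis by simp
  qed
  let ?f = "\<lambda>x. N.prob {y \<in> space ?N. \<forall>k\<in>?b ` K. y k \<le> x k}"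
  have f_measurable: "?f \<in> borel_measurable (ebox_borel d)"
  proof -
    have "Measurable.pred (ebox_borel d \<Otimes>\<^sub>M ?N) (\<lambda>z. \<forall>k\<in>?b ` K. snd z k \<le> fst z k)"
      using bK fin
      by (intro measurable_dominance measurable_compose[OF measurable_fst measurable_component_ebox]
          measurable_compose[OF measurable_snd comp]) auto
    then show ?thesis
      unfolding ind by (intro N.borel_measurable_lebesgue_integral) (simp add: split_beta')
  qed
  have "bracket (card (?b ` K)) (margin d (?b ` K) C) (margin d (?b ` K) C) = (\<integral>x. ?f x \<partial>?N)"
    unfolding C_def order_transform_product_copula by (rule N.bracket_margin_cop[OF bK])
  \<comment> \<open>Invariance of \<open>?N\<close> is used twice: here for the outer variable, and
    below for the inner one.\<close>
  also have "\<dots> = (\<integral>x. ?f x \<partial>distr ?N (ebox_borel d) ?R)"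
    by (simp only: distr_reflect_order_stats)
  also have "\<dots> = (\<integral>x. ?f (?R x) \<partial>?N)"
    by (rule integral_distr[OF R f_measurable])
  also have "\<dots> = (\<integral>x. N.prob {y \<in> space ?N. \<forall>k\<in>K. x k \<le> y k} \<partial>?N)"
  proof (rule Bochner_Integration.integral_cong[OF refl])
    fix x
    let ?B = "{y \<in> space (ebox_borel d). \<forall>k\<in>?b ` K. y k \<le> ?R x k}"
    have B: "?B \<in> sets (ebox_borel d)"
      using bK fin
      by (intro predE measurable_dominance measurable_component_ebox measurable_const) auto
    have "?f (?R x) = measure (distr ?N (ebox_borel d) ?R) ?B"
      unfolding distr_reflect_order_stats space ..
    also have "\<dots> = N.prob (?R -` ?B \<inter> space ?N)"
      by (rule measure_distr[OF R B])
    also have "?R -` ?B \<inter> space ?N = {y \<in> space ?N. \<forall>k\<in>K. x k \<le> y k}"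
      using R_le measurable_space[OF R] by auto
    finally show "?f (?R x) = N.prob {y \<in> space ?N. \<forall>k\<in>K. x k \<le> y k}" .
  qed
  also have "\<dots> = (\<integral>x. \<integral>y. (if \<forall>k\<in>K. x k \<le> y k then 1 else 0) \<partial>?N \<partial>?N)"
    by (simp only: ind)
  \<comment> \<open>Exchangeability of the two independent copies takes the form of exchanging the
    integrals, which restores the direction of dominance.\<close>
  also have "\<dots> = (\<integral>y. \<integral>x. (if \<forall>k\<in>K. x k \<le> y k then 1 else 0) \<partial>?N \<partial>?N)"
  proof (rule NN.Fubini_integral[symmetric])
    have "Measurable.pred (?N \<Otimes>\<^sub>M ?N) (\<lambda>z. \<forall>k\<in>K. fst z k \<le> snd z k)"
      using K comp by (intro measurable_dominance fin measurable_compose[OF measurable_fst] measurable_compose[OF measurable_snd]) auto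
    then show "integrable (?N \<Otimes>\<^sub>M ?N) (\<lambda>(x, y). if \<forall>k\<in>K. x k \<le> y k then 1 else 0 :: real)"
      by (intro NN.integrable_const_bound[of _ 1]) (auto simp: split_beta')
  qed
  also have "\<dots> = (\<integral>x. N.prob {y \<in> space ?N. \<forall>k\<in>K. y k \<le> x k} \<partial>?N)"
    by (simp only: ind)
  also have "\<dots> = bracket (card K) (margin d K C) (margin d K C)"
    unfolding C_def order_transform_product_copula by (rule N.bracket_margin_cop[OF K, symmetric])
  finally show ?thesis .
qed

theorem theorem6p7:
  fixes d :: nat
  assumes "2 \<le> d"
  shows "(\<forall>K. K \<subseteq> {1..d} \<and> 2 \<le> card K \<longrightarrow>
            bracket (card (reflect_index d ` K))
              (margin d (reflect_index d ` K) (order_transform d (product_copula d)))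
              (margin d (reflect_index d ` K) (order_transform d (product_copula d)))
            = bracket (card K)
                (margin d K (order_transform d (product_copula d)))
                (margin d K (order_transform d (product_copula d))))
       \<and> (\<forall>K. K \<subseteq> {1..d} \<and> 2 \<le> card K \<longrightarrow>
            kendall_tau (card (reflect_index d ` K))
              (margin d (reflect_index d ` K) (order_transform d (product_copula d)))
            = kendall_tau (card K)
                (margin d K (order_transform d (product_copula d))))"
proof -
  \<comment> \<open>\<open>reflect_index d\<close> is an involution on \<open>{1..d}\<close>. Equal
    cardinalities give equal normalising constants in \<open>kendall_tau\<close>.\<close>
  have "card (reflect_index d ` K) = card K" if "K \<subseteq> {1..d}" for K
    using that reflect_index_idem by (intro card_image inj_on_inverseI[of _ "reflect_index d"]) blast
  then show ?thesis
    using bracket_reflect[of _ d] by (auto simp: kendall_tau_def)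
qed

end
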